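(* Let $A\in\mathbb{R}^{n\times n}$, $B\in\mathbb{R}^{n\times m}$, and let $\mathcal{D}=\{(U_i,X_{0,i},X_i)\}_{i=1}^{M}$ be a (noiseless) dataset generated by the system $x(t+1)=Ax(t)+Bu(t)$ with experiment horizons $T_1,\dots,T_M$, as described in the context. Let $T\ge1$, let $k_1,\dots,k_\ell\in\{1,\dots,M\}$ be (possibly repeated) indices such that $\sum_{i=1}^{\ell}T_{k_i}=T$, and let $x_0,x_{\mathrm f}\in\mathbb{R}^n$ be such that $x_{\mathrm f}$ is reachable in $T$ steps from $x_0$. Assume that $\begin{bmatrix}X_{0,k_i}\\ U_{k_i}\end{bmatrix}$ has full row rank for all $i\in\{1,\dots,\ell\}$. Then the $T$-steps minimum-energy control input $u_T^*$ driving the system from $x_0$ to $x_{\mathrm f}$ can be expressed as $$u_T^*=\bigl(I-GK_{\bar H}(GK_{\bar H})^{\dagger}\bigr)\,G\bar H^{\dagger}\begin{bmatrix}x_0\\ x_{\mathrm f}\end{bmatrix},$$ where, for $i\in\{1,\dots,\ell\}$, $\tilde U_i=U_{k_i}K_{X_{0,k_i}}$, $\tilde X_i=X_{k_i}K_{X_{0,k_i}}$, $Q_i=X_{k_i}K_{U_{k_i}}(X_{0,k_i}K_{U_{k_i}})^{\dagger}$, and $$G=\begin{bmatrix}\tilde U_\ell&0&\cdots&0&0\\ 0&\tilde U_{\ell-1}&\ddots&\vdots&\vdots\\ \vdots&\ddots&\ddots&0&0\\ 0&\cdots&0&\tilde U_1&0\end{bmatrix}$$ (the last block column being zero with $n$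 columns), $$\bar H=\begin{bmatrix}0&0&\cdots&0&0&I_n\\ \tilde X_\ell&Q_\ell\tilde X_{\ell-1}&\cdots&Q_\ell\cdots Q_3\tilde X_2&Q_\ell\cdots Q_2\tilde X_1&Q_\ell Q_{\ell-1}\cdots Q_1\end{bmatrix}.$$
   Context: System: $x(t+1)=Ax(t)+Bu(t)$, $x(0)=x_0\in\mathbb{R}^n$, with $x(t)\in\mathbb{R}^n$, $u(t)\in\mathbb{R}^m$. The $T$-steps controllability matrix is $C_T=[B\ \ AB\ \cdots\ A^{T-1}B]$. A $T$-steps input sequence is written in reversed time order as $u_T=[u(T-1)^{\mathsf T},\dots,u(0)^{\mathsf T}]^{\mathsf T}\in\mathbb{R}^{mT}$, so that $x(T)=A^Tx(0)+C_Tu_T$. Dataset: there are $M$ distinct horizons $T_1,\dots,T_M\in\mathbb{N}$ (positive integers). For each $i$, $N_i$ experiments of horizon $T_i$ are performed with arbitrary inputs and initial states. $U_i\in\mathbb{R}^{mT_i\times N_i}$, $X_{0,i}\in\mathbb{R}^{n\times N_i}$, $X_i\in\mathbb{R}^{n\times N_i}$ collect as columns the input sequences (each stacked in reversed time order, i.e. as $[u(T_i-1)^{\mathsf T},\dots,u(0)^{\mathsf T}]^{\mathsf T}$), the initial states, and the states at time $T_i$, respectively; thus $X_i=A^{T_i}X_{0,i}+C_{T_i}U_i$. Reachability: $x_{\mathrm f}$ is reachable in $T$ steps from $x_0$ if $x_{\mathrm f}-A^Tx_0\in\operatorname{Im}(C_T)$. Minimum-energy control: $u_T^*$ is the unique minimizer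 of $\|u_T\|_2^2$ over $u_T\in\mathbb{R}^{mT}$ subject to $x(t+1)=Ax(t)+Bu(t)$, $x(0)=x_0$, $x(T)=x_{\mathrm f}$; under reachability, $u_T^*=C_T^\dagger(x_{\mathrm f}-A^Tx_0)$. Notation: $A^\dagger$ is the Moore–Penrose pseudoinverse; $K_A$ is a matrix whose columns form a basis of $\operatorname{Ker}(A)$ (any fixed choice of basis). *)

theory Defs
  imports
    "Jordan_Normal_Form.Matrix_Kernel"
    "Jordan_Normal_Form.DL_Rank"
begin

definition append_cols :: "'a :: zero mat \<Rightarrow> 'a mat \<Rightarrow> 'a mat" where
  "append_cols P R = four_block_mat P R (0\<^sub>m 0 (dim_col P)) (0\<^sub>m 0 (dim_col R))"

(* The number of rows is an argument so that the empty block row has a shape. *)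
definition block_row :: "nat \<Rightarrow> 'a :: zero mat list \<Rightarrow> 'a mat" where
  "block_row nr Ps = foldr append_cols Ps (0\<^sub>m nr 0)"

(* Moore-Penrose pseudoinverse of a real matrix, through the four Penrose conditions. *)
definition is_pinv :: "real mat \<Rightarrow> real mat \<Rightarrow> bool" where
  "is_pinv P R \<longleftrightarrow> R \<in> carrier_mat (dim_col P) (dim_row P) \<and>
     P * R * P = P \<and> R * P * R = R \<and>
     transpose_mat (P * R) = P * R \<and> transpose_mat (R * P) = R * P"

definition pinv :: "real mat \<Rightarrow> real mat" where
  "pinv P = (THE R. is_pinv P R)"

(* The columns of R, listed without repetition, are a basis of Ker P;
   R has no columns when the kernel is trivial. *)
definition kernel_basis_mat :: "real mat \<Rightarrow> real mat \<Rightarrow> bool" where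
  "kernel_basis_mat P R \<longleftrightarrow> dim_row R = dim_col P \<and> distinct (cols R) \<and>
     kernel.basis (dim_col P) P (set (cols R))"

definition full_row_rank :: "real mat \<Rightarrow> bool" where
  "full_row_rank P \<longleftrightarrow> vec_space.rank (dim_row P) P = dim_row P"

fun state :: "real mat \<Rightarrow> real mat \<Rightarrow> real vec \<Rightarrow> (nat \<Rightarrow> real vec) \<Rightarrow> nat \<Rightarrow> real vec" where
  "state A B x0 u 0 = x0"
| "state A B x0 u (Suc t) = A *\<^sub>v state A B x0 u t + B *\<^sub>v u t"

(* The input u(t) in R^m encoded by a stacked sequence v = (u(T-1), ..., u(0)) in R^(mT). *)
definition input_at :: "nat \<Rightarrow> nat \<Rightarrow> real vec \<Rightarrow> nat \<Rightarrow> real vec" where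
  "input_at m T v t = vec m (\<lambda>j. v $ ((T - 1 - t) * m + j))"

definition ctrb :: "real mat \<Rightarrow> real mat \<Rightarrow> nat \<Rightarrow> real mat" where
  "ctrb A B T = block_row (dim_row A) (map (\<lambda>t. A ^\<^sub>m t * B) [0..<T])"

definition reachable :: "real mat \<Rightarrow> real mat \<Rightarrow> nat \<Rightarrow> real vec \<Rightarrow> real vec \<Rightarrow> bool" where
  "reachable A B T x0 xf \<longleftrightarrow>
     xf - (A ^\<^sub>m T) *\<^sub>v x0 \<in> (\<lambda>v. ctrb A B T *\<^sub>v v) ` carrier_vec (dim_col (ctrb A B T))"

(* N experiments of horizon T; column j of U, X0, X holds the stacked input,
   the initial state and the state at time T of the j-th one. *)
definition experiments ::
  "real mat \<Rightarrow> real mat \<Rightarrow> nat \<Rightarrow> nat \<Rightarrow> real mat \<Rightarrow> real mat \<Rightarrow> real mat \<Rightarrow> bool" where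
  "experiments A B T N U X0 X \<longleftrightarrow>
     U \<in> carrier_mat (dim_col B * T) N \<and>
     X0 \<in> carrier_mat (dim_row A) N \<and>
     X \<in> carrier_mat (dim_row A) N \<and>
     (\<forall>j<N. col X j = state A B (col X0 j) (input_at (dim_col B) T (col U j)) T)"

definition steers ::
  "real mat \<Rightarrow> real mat \<Rightarrow> nat \<Rightarrow> real vec \<Rightarrow> real vec \<Rightarrow> real vec \<Rightarrow> bool" where
  "steers A B T x0 xf v \<longleftrightarrow> v \<in> carrier_vec (dim_col B * T) \<and>
     state A B x0 (input_at (dim_col B) T v) T = xf"

(* v is the unique minimizer of the squared Euclidean norm among the steering inputs. *)
definition min_energy_control ::
  "real mat \<Rightarrow> real mat \<Rightarrow> nat \<Rightarrow> real vec \<Rightarrow> real vec \<Rightarrow> real vec \<Rightarrow> bool" where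
  "min_energy_control A B T x0 xf v \<longleftrightarrow>
     is_arg_min (\<lambda>w. w \<bullet> w) (steers A B T x0 xf) v \<and>
     (\<forall>w. is_arg_min (\<lambda>w. w \<bullet> w) (steers A B T x0 xf) w \<longrightarrow> w = v)"

(* Families of blocks are indexed from 1 to l, and blocks occur in the order l, ..., 1. *)
definition G_mat :: "nat \<Rightarrow> nat \<Rightarrow> (nat \<Rightarrow> real mat) \<Rightarrow> real mat" where
  "G_mat n l Ut =
     (let D = diag_block_mat (map Ut (rev [1..<Suc l]))
      in append_cols D (0\<^sub>m (dim_row D) n))"

(* Q_l * Q_(l-1) * ... * Q_i, which is the identity for i = l + 1 *)
definition Q_prod :: "nat \<Rightarrow> nat \<Rightarrow> (nat \<Rightarrow> real mat) \<Rightarrow> nat \<Rightarrow> real mat" where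
  "Q_prod n l Q i = foldr (*) (map Q (rev [i..<Suc l])) (1\<^sub>m n)"

definition H_mat :: "nat \<Rightarrow> nat \<Rightarrow> (nat \<Rightarrow> real mat) \<Rightarrow> (nat \<Rightarrow> real mat) \<Rightarrow> real mat" where
  "H_mat n l Xt Q =
     (let R = block_row n (map (\<lambda>i. Q_prod n l Q (Suc i) * Xt i) (rev [1..<Suc l]))
      in four_block_mat (0\<^sub>m n (dim_col R)) (1\<^sub>m n) R (Q_prod n l Q 1))"

end

theory Submission
  imports Defs "Jordan_Normal_Form.Gauss_Jordan_Elimination"
begin

text \<open>
  Full row rank of \<open>[X\<^sub>0; U]\<close> means that initial states and inputs can be prescribed independently
  by combining experiments. Combinations with zero initial state give \<open>X K = C U K\<close> with \<open>U K\<close>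
  onto, and combinations with zero input show that \<open>Q\<close> is the power of \<open>A\<close> at the horizon.
  Concatenating the horizons, the last block row of \<open>H\<close> is \<open>C D\<close> followed by the \<open>T\<close>-th power of
  \<open>A\<close>, with \<open>D\<close> the block-diagonal part of \<open>G\<close>, which is onto the input space. Therefore
  \<open>G H\<^sup>\<dagger> (x\<^sub>0, x\<^sub>f)\<close> is a steering input, and the range of \<open>G K\<^sub>H\<close> is exactly the kernel of \<open>C\<close>.
  Removing from the steering input its orthogonal projection onto that kernel leaves the one of
  least norm.
\<close>

subsection \<open>Matrices and vectors\<close>

lemma mult_mat_assoc_dim:
  fixes A :: "'a :: semiring_0 mat"
  assumes "dim_col A = dim_row B" "dim_col B = dim_row C"
  shows "A * B * C = A * (B * C)"
  using assms by (intro assoc_mult_mat[of A "dim_row A" "dim_row B" B "dim_row C" C "dim_col C"]) auto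

text \<open>Unit vectors recover the entries. With this, identities between block matrices become
  computations on split vectors, where associativity and distributivity are easier to apply.\<close>

lemma mat_eqI_mult_vec:
  fixes A B :: "'a :: comm_semiring_1 mat"
  assumes A: "A \<in> carrier_mat nr nc" and B: "B \<in> carrier_mat nr nc"
    and eq: "\<And>v. v \<in> carrier_vec nc \<Longrightarrow> A *\<^sub>v v = B *\<^sub>v v"
  shows "A = B"
proof (rule eq_matI)
  fix i j assume ij: "i < dim_row B" "j < dim_col B"
  have "M $$ (i, j) = (M *\<^sub>v unit_vec nc j) $ i" if "M \<in> carrier_mat nr nc" for M :: "'a mat"
    using that ij B by (simp add: scalar_prod_right_unit)
  then show "A $$ (i, j) = B $$ (i, j)" using eq[of "unit_vec nc j"] A B by simp
qed (use A B in auto)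

lemma scalar_prod_self_eq_0:
  fixes v :: "real vec"
  assumes "v \<bullet> v = 0"
  shows "v = 0\<^sub>v (dim_vec v)"
proof (rule eq_vecI)
  fix i assume i: "i < dim_vec (0\<^sub>v (dim_vec v) :: real vec)"
  have "(\<Sum>i = 0..<dim_vec v. v $ i * v $ i) = 0" using assms by (simp add: scalar_prod_def)
  then have "\<forall>i \<in> {0..<dim_vec v}. v $ i * v $ i = 0"
    by (subst (asm) sum_nonneg_eq_0_iff) auto
  then show "v $ i = 0\<^sub>v (dim_vec v) $ i" using i by simp
qed simp

section \<open>Juxtaposition of blocks and its action on split vectors\<close>

lemma append_cols_carrier [simp]:
  "P \<in> carrier_mat r c \<Longrightarrow> R \<in> carrier_mat r d \<Longrightarrow> append_cols P R \<in> carrier_mat r (c + d)"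
  unfolding append_cols_def by auto

lemma dim_append_cols [simp]:
  "dim_row (append_cols P R) = dim_row P" "dim_col (append_cols P R) = dim_col P + dim_col R"
  unfolding append_cols_def by auto

lemma index_append_cols:
  "i < dim_row P \<Longrightarrow> j < dim_col P + dim_col R \<Longrightarrow>
   append_cols P R $$ (i, j) = (if j < dim_col P then P $$ (i, j) else R $$ (i, j - dim_col P))"
  unfolding append_cols_def by auto

lemma append_cols_mult_vec:
  fixes P R :: "'a :: comm_semiring_1 mat"
  assumes P: "P \<in> carrier_mat r c" and R: "R \<in> carrier_mat r d"
    and v: "v \<in> carrier_vec c" and w: "w \<in> carrier_vec d"
  shows "append_cols P R *\<^sub>v (v @\<^sub>v w) = P *\<^sub>v v + R *\<^sub>v w"
proof -
  have "append_cols P R *\<^sub>v (v @\<^sub>v w) = (P *\<^sub>v v + R *\<^sub>v w) @\<^sub>v (0\<^sub>m 0 c *\<^sub>v v + 0\<^sub>m 0 d *\<^sub>v w)"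
    unfolding append_cols_def using P R v w by (subst four_block_mat_mult_vec[of _ r c _ d _ 0]) auto
  \<comment> \<open>The lower half of the block product has length 0 and disappears.\<close>
  also have "\<dots> = P *\<^sub>v v + R *\<^sub>v w" using P R by (intro eq_vecI) auto
  finally show ?thesis .
qed

lemma append_cols_assoc:
  assumes "dim_row P = dim_row R"
  shows "append_cols (append_cols P R) S = append_cols P (append_cols R S)"
  using assms by (intro eq_matI) (auto simp: index_append_cols)

lemma append_cols_empty [simp]:
  assumes "P \<in> carrier_mat r c"
  shows "append_cols (0\<^sub>m r 0) P = P"
  using assms by (auto intro!: eq_matI simp: index_append_cols)

lemma append_vec_split:
  assumes "v \<in> carrier_vec (c + d)"
  obtains x y where "v = x @\<^sub>v y" "x \<in> carrier_vec c" "y \<in> carrier_vec d"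
  using vec_first_last_append[OF assms] by (metis vec_first_carrier vec_last_carrier)

lemma mult_append_cols:
  fixes A P R :: "'a :: comm_semiring_1 mat"
  assumes A: "A \<in> carrier_mat q r" and P: "P \<in> carrier_mat r c" and R: "R \<in> carrier_mat r d"
  shows "A * append_cols P R = append_cols (A * P) (A * R)"
proof (rule mat_eqI_mult_vec[of _ q "c + d"])
  fix v :: "'a vec" assume "v \<in> carrier_vec (c + d)"
  then obtain x y where v: "v = x @\<^sub>v y" "x \<in> carrier_vec c" "y \<in> carrier_vec d"
    by (rule append_vec_split)
  have PR: "append_cols P R \<in> carrier_mat r (c + d)" using P R by simp
  have "(A * append_cols P R) *\<^sub>v v = A *\<^sub>v (P *\<^sub>v x + R *\<^sub>v y)"
    unfolding v(1) by (subst assoc_mult_mat_vec[OF A PR]) (use v append_cols_mult_vec[OF P R] in auto)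
  also have "\<dots> = A *\<^sub>v (P *\<^sub>v x) + A *\<^sub>v (R *\<^sub>v y)"
    by (rule mult_add_distrib_mat_vec[OF A]) (use P R v in auto)
  also have "\<dots> = append_cols (A * P) (A * R) *\<^sub>v v" unfolding v(1)
    using A P R v by (subst append_cols_mult_vec[of _ q c _ d]) auto
  finally show "(A * append_cols P R) *\<^sub>v v = append_cols (A * P) (A * R) *\<^sub>v v" .
qed (use A P R in auto)

lemma mult_mat_zero_vec:
  fixes A :: "'a :: comm_semiring_1 mat"
  assumes "A \<in> carrier_mat nr nc"
  shows "A *\<^sub>v 0\<^sub>v nc = 0\<^sub>v nr"
proof (rule eq_vecI)
  fix i assume "i < dim_vec (0\<^sub>v nr :: 'a vec)"
  moreover have "row A i \<in> carrier_vec nc" using assms by auto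
  ultimately show "(A *\<^sub>v 0\<^sub>v nc) $ i = 0\<^sub>v nr $ i" using assms by simp
qed (use assms in simp)

lemma zero_vec_append: "0\<^sub>v c @\<^sub>v 0\<^sub>v d = 0\<^sub>v (c + d)"
  by (intro eq_vecI) auto

text \<open>This moves block-diagonal factors out of a block row: it is how
  \<open>diag_block_mat\<close> of the blocks \<open>Ut\<close> separates from the controllability
  matrix when horizons are concatenated.\<close>

lemma append_cols_mult_block_diag:
  fixes P R E F :: "'a :: comm_semiring_1 mat"
  assumes P: "P \<in> carrier_mat r p" and R: "R \<in> carrier_mat r q"
    and E: "E \<in> carrier_mat p c" and F: "F \<in> carrier_mat q d"
  shows "append_cols P R * four_block_mat E (0\<^sub>m p d) (0\<^sub>m q c) F = append_cols (P * E) (R * F)"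
proof (rule mat_eqI_mult_vec[of _ r "c + d"])
  have PR: "append_cols P R \<in> carrier_mat r (p + q)" using P R by simp
  have D: "four_block_mat E (0\<^sub>m p d) (0\<^sub>m q c) F \<in> carrier_mat (p + q) (c + d)" using E F by simp
  show "append_cols P R * four_block_mat E (0\<^sub>m p d) (0\<^sub>m q c) F \<in> carrier_mat r (c + d)"
    using PR D by simp
  fix v :: "'a vec" assume "v \<in> carrier_vec (c + d)"
  then obtain x y where v: "v = x @\<^sub>v y" and x: "x \<in> carrier_vec c" and y: "y \<in> carrier_vec d"
    by (rule append_vec_split)
  have vc: "v \<in> carrier_vec (c + d)" unfolding v using x y by simp
  have "four_block_mat E (0\<^sub>m p d) (0\<^sub>m q c) F *\<^sub>v v = E *\<^sub>v x @\<^sub>v F *\<^sub>v y"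
    unfolding v using E F x y by (subst four_block_mat_mult_vec[of _ p c _ d _ q]) auto
  then have "(append_cols P R * four_block_mat E (0\<^sub>m p d) (0\<^sub>m q c) F) *\<^sub>v v
      = P *\<^sub>v (E *\<^sub>v x) + R *\<^sub>v (F *\<^sub>v y)"
    unfolding assoc_mult_mat_vec[OF PR D vc] using append_cols_mult_vec[OF P R] E F x y by simp
  also have "\<dots> = append_cols (P * E) (R * F) *\<^sub>v v"
    unfolding v using append_cols_mult_vec[of "P * E" r c "R * F" d x y] P R E F x y by simp
  finally show "(append_cols P R * four_block_mat E (0\<^sub>m p d) (0\<^sub>m q c) F) *\<^sub>v v
    = append_cols (P * E) (R * F) *\<^sub>v v" .
qed (use P R E F in auto)

subsection \<open>Moore-Penrose inverse\<close>

text \<open>If the Gram matrix of \<open>A\<close> kills \<open>d\<close>, then the squared norm of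
  \<open>A d\<close> is the scalar product of \<open>d\<close> with the Gram matrix applied to
  \<open>d\<close>, hence 0. Apply this to \<open>d = X v - Y v\<close> for every
  \<open>v\<close>.\<close>

lemma gram_cancel:
  fixes A X Y :: "real mat"
  assumes A: "A \<in> carrier_mat nr nc" and X: "X \<in> carrier_mat nc k" and Y: "Y \<in> carrier_mat nc k"
    and eq: "A\<^sup>T * A * X = A\<^sup>T * A * Y"
  shows "A * X = A * Y"
proof (rule mat_eqI_mult_vec[of _ nr k])
  fix v :: "real vec" assume v: "v \<in> carrier_vec k"
  have Xv: "X *\<^sub>v v \<in> carrier_vec nc" and Yv: "Y *\<^sub>v v \<in> carrier_vec nc" using X Y v by auto
  define d where "d = X *\<^sub>v v - Y *\<^sub>v v"
  have d: "d \<in> carrier_vec nc" unfolding d_def using Xv Yv by auto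
  have At: "A\<^sup>T \<in> carrier_mat nc nr" and AtA: "A\<^sup>T * A \<in> carrier_mat nc nc" using A by auto
  have "(A\<^sup>T * A) *\<^sub>v (X *\<^sub>v v) = (A\<^sup>T * A) *\<^sub>v (Y *\<^sub>v v)"
    using arg_cong[OF eq, of "\<lambda>M. M *\<^sub>v v"]
    by (subst (asm) (1 2) assoc_mult_mat_vec[OF AtA _ v]) (use X Y in auto)
  then have "(A\<^sup>T * A) *\<^sub>v d = 0\<^sub>v nc"
    unfolding d_def mult_minus_distrib_mat_vec[OF AtA Xv Yv] using AtA Yv by (intro eq_vecI) auto
  then have z: "A\<^sup>T *\<^sub>v (A *\<^sub>v d) = 0\<^sub>v nc" using assoc_mult_mat_vec[OF At A d] by simp
  have "(A *\<^sub>v d) \<bullet> (A *\<^sub>v d) = (A\<^sup>T *\<^sub>v (A *\<^sub>v d)) \<bullet> d"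
    by (rule transpose_vec_mult_scalar[OF A d, symmetric]) (use A d in auto)
  also have "\<dots> = 0" unfolding z using d by simp
  finally have "A *\<^sub>v d = 0\<^sub>v nr" using scalar_prod_self_eq_0 A by fastforce
  then have e: "A *\<^sub>v (X *\<^sub>v v) - A *\<^sub>v (Y *\<^sub>v v) = 0\<^sub>v nr"
    unfolding d_def mult_minus_distrib_mat_vec[OF A Xv Yv] .
  have "A *\<^sub>v (X *\<^sub>v v) = A *\<^sub>v (Y *\<^sub>v v)"
  proof (rule eq_vecI)
    fix i assume "i < dim_vec (A *\<^sub>v (Y *\<^sub>v v))"
    then show "(A *\<^sub>v (X *\<^sub>v v)) $ i = (A *\<^sub>v (Y *\<^sub>v v)) $ i"
      using arg_cong[OF e, of "\<lambda>w. w $ i"] A by simp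
  qed simp
  then show "(A * X) *\<^sub>v v = (A * Y) *\<^sub>v v"
    using assoc_mult_mat_vec[OF A X v] assoc_mult_mat_vec[OF A Y v] by simp
qed (use A X Y in auto)

text \<open>Gauss-Jordan elimination gives \<open>E = P * A\<close> in reduced echelon form with
  \<open>P\<close> invertible. A generalized inverse \<open>Z\<close> of \<open>E\<close> can be
  read off from its pivots, and \<open>Z * P\<close> then serves for \<open>A\<close>.\<close>

lemma ex_generalized_inverse:
  fixes A :: "'a :: field mat"
  assumes A: "A \<in> carrier_mat nr nc"
  shows "\<exists>Z \<in> carrier_mat nc nr. A * Z * A = A"
proof -
  obtain E E' where gj: "gauss_jordan A (0\<^sub>m nr 0) = (E, E')" by force
  from gauss_jordan_transform[OF A zero_carrier_mat gj, where b = "()"] obtain P where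
    PU: "P \<in> Units (ring_mat TYPE('a) nr ())" and E: "E = P * A" by auto
  from PU obtain P' where P: "P \<in> carrier_mat nr nr" and P': "P' \<in> carrier_mat nr nr"
    and inv: "P' * P = 1\<^sub>m nr" by (auto simp: Units_def ring_mat_def)
  have Ec: "E \<in> carrier_mat nr nc" using E P A by auto
  have "P' * E = (P' * P) * A" unfolding E using P' P A by simp
  then have AE: "A = P' * E" using inv A by simp
  have "row_echelon_form E" using gauss_jordan_row_echelon[OF A gj] .
  then obtain f where piv: "pivot_fun E f nc" unfolding row_echelon_form_def using Ec by auto
  have dE: "dim_row E = nr" using Ec by auto
  note p = pivot_funD[OF dE piv]
  \<comment> \<open>Column \<open>i\<close> of \<open>Z\<close> is the unit vector at the pivot of
    row \<open>i\<close>. A zero row has \<open>f i = nc\<close>, and the corresponding column of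
    \<open>Z\<close> is zero. So \<open>E * Z\<close> is diagonal, with a 1 exactly at the nonzero
    rows of \<open>E\<close>.\<close>
  define Z :: "'a mat" where "Z = mat nc nr (\<lambda>(j, i). if j = f i then 1 else 0)"
  have Z: "Z \<in> carrier_mat nc nr" unfolding Z_def by auto
  have EZ: "(E * Z) $$ (i, i') = (if i = i' \<and> f i < nc then 1 else 0)" if i: "i < nr" "i' < nr" for i i'
  proof -
    have "(E * Z) $$ (i, i') = (\<Sum>j = 0..<nc. E $$ (i, j) * (if j = f i' then 1 else 0))"
      using i Ec Z unfolding times_mat_def scalar_prod_def by (simp add: Z_def)
    also have "\<dots> = (\<Sum>j = 0..<nc. if j = f i' then E $$ (i, j) else 0)"
      by (rule sum.cong) auto
    also have "\<dots> = (if f i' < nc then E $$ (i, f i') else 0)" by simp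
    also have "\<dots> = (if i = i' \<and> f i < nc then 1 else 0)" using p(4,5) i by auto
    finally show ?thesis .
  qed
  have EZE: "E * Z * E = E"
  proof (rule eq_matI)
    fix i j assume "i < dim_row E" "j < dim_col E"
    then have i: "i < nr" and j: "j < nc" using Ec by auto
    have "(E * Z * E) $$ (i, j) = (\<Sum>k = 0..<nr. (E * Z) $$ (i, k) * E $$ (k, j))"
    proof -
      \<comment> \<open>A general \<open>W\<close> keeps the inner product \<open>E * Z\<close>
        unexpanded, so that its entries can be taken from \<open>EZ\<close>.\<close>
      have "(W * E) $$ (i, j) = (\<Sum>k = 0..<nr. W $$ (i, k) * E $$ (k, j))" if W: "W \<in> carrier_mat nr nr" for W
        using i j Ec W by (simp add: scalar_prod_def)
      then show ?thesis by this (use Ec Z in auto)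
    qed
    also have "\<dots> = (\<Sum>k = 0..<nr. if i = k then (if f i < nc then E $$ (i, j) else 0) else 0)"
      by (rule sum.cong) (use EZ i in auto)
    also have "\<dots> = (if f i < nc then E $$ (i, j) else 0)" using i by simp
    also have "\<dots> = E $$ (i, j)" using p(1,2)[of i] i j by (metis le_neq_implies_less)
    finally show "(E * Z * E) $$ (i, j) = E $$ (i, j)" .
  qed (use Ec Z in auto)
  have "A * (Z * P) * A = A * (Z * (P * A))"
    using carrier_matD[OF A] carrier_matD[OF Z] carrier_matD[OF P] by (simp add: mult_mat_assoc_dim)
  also have "\<dots> = P' * (E * Z * E)" unfolding E[symmetric]
    using carrier_matD[OF Ec] carrier_matD[OF Z] carrier_matD[OF P'] by (simp add: AE mult_mat_assoc_dim)
  finally have "A * (Z * P) * A = A" unfolding EZE AE[symmetric] .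
  then show ?thesis using Z P by (intro bexI[of _ "Z * P"]) auto
qed

text \<open>Solve the normal equations: with \<open>Y\<close> a generalized inverse of the Gram
  matrix of \<open>A\<close>, take \<open>L\<close> to be \<open>Y\<close> times the transpose of
  \<open>A\<close>. Cancelling in the Gram identity yields \<open>A * L * A = A\<close>.\<close>

lemma ex_least_squares_inverse:
  fixes A :: "real mat"
  assumes A: "A \<in> carrier_mat nr nc"
  shows "\<exists>L \<in> carrier_mat nc nr. A * L * A = A \<and> (A * L)\<^sup>T = A * L"
proof -
  have At: "A\<^sup>T \<in> carrier_mat nc nr" and AtA: "A\<^sup>T * A \<in> carrier_mat nc nc" using A by auto
  obtain Y where Y: "Y \<in> carrier_mat nc nc" and g: "A\<^sup>T * A * Y * (A\<^sup>T * A) = A\<^sup>T * A"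
    using ex_generalized_inverse[OF AtA] by auto
  define L where "L = Y * A\<^sup>T"
  have L: "L \<in> carrier_mat nc nr" unfolding L_def using Y A by auto
  have "A\<^sup>T * A * (Y * (A\<^sup>T * A)) = A\<^sup>T * A * 1\<^sub>m nc"
    using g Y AtA A by (subst assoc_mult_mat[OF AtA Y AtA, symmetric]) auto
  then have "A * (Y * (A\<^sup>T * A)) = A * 1\<^sub>m nc"
    by (intro gram_cancel[OF A]) (use Y AtA in auto)
  then have ALA: "A * L * A = A"
    unfolding L_def using carrier_matD[OF A] carrier_matD[OF Y] by (simp add: mult_mat_assoc_dim A)
  have AL: "A * L \<in> carrier_mat nr nr" using A L by auto
  \<comment> \<open>Symmetry without any symmetry of \<open>Y\<close>: \<open>A * L\<close> is shown
    to equal itself times its own transpose, and such a product is symmetric.\<close>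
  have "A * L = A * Y * (A * L * A)\<^sup>T" unfolding ALA using A Y by (simp add: L_def)
  also have "\<dots> = A * Y * (A\<^sup>T * (A * L)\<^sup>T)" using transpose_mult[OF AL A] by simp
  also have "\<dots> = A * L * (A * L)\<^sup>T"
  proof -
    have AY: "A * Y \<in> carrier_mat nr nc" and ALt: "(A * L)\<^sup>T \<in> carrier_mat nr nr" using A Y AL by auto
    have "A * L = A * Y * A\<^sup>T" using A Y by (simp add: L_def)
    then show ?thesis using assoc_mult_mat[OF AY At ALt] by simp
  qed
  finally have e: "A * L = A * L * (A * L)\<^sup>T" .
  have "(A * L)\<^sup>T = (A * L * (A * L)\<^sup>T)\<^sup>T" using e by simp
  also have "\<dots> = A * L * (A * L)\<^sup>T" using transpose_mult[of "A * L" nr nr "(A * L)\<^sup>T" nr] AL by simp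
  finally show ?thesis using ALA L e by auto
qed

lemma ex_is_pinv: "\<exists>R. is_pinv P R"
proof -
  define r c where "r = dim_row P" and "c = dim_col P"
  have P: "P \<in> carrier_mat r c" unfolding r_def c_def by auto
  obtain L where L: "L \<in> carrier_mat c r" "P * L * P = P" "(P * L)\<^sup>T = P * L"
    using ex_least_squares_inverse[OF P] by auto
  have Pt: "P\<^sup>T \<in> carrier_mat c r" using P by auto
  obtain N where N: "N \<in> carrier_mat r c" "P\<^sup>T * N * P\<^sup>T = P\<^sup>T" "(P\<^sup>T * N)\<^sup>T = P\<^sup>T * N"
    using ex_least_squares_inverse[OF Pt] by auto
  \<comment> \<open>\<open>L\<close> is a (1,3)-inverse and \<open>M\<close> a (1,4)-inverse of \<open>P\<close>, so \<open>M * P * L\<close> satisfies all four conditions.\<close>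
  define M where "M = N\<^sup>T"
  have M: "M \<in> carrier_mat c r" unfolding M_def using N by auto
  have MP: "M * P = P\<^sup>T * N" unfolding M_def using N(3) transpose_mult[OF Pt N(1)] by simp
  have sM: "(M * P)\<^sup>T = M * P" unfolding MP using N(3) .
  have "(P\<^sup>T * N * P\<^sup>T)\<^sup>T = P * (M * P)"
    using transpose_mult[of "P\<^sup>T * N" c c "P\<^sup>T" r] N Pt MP by simp
  then have PMP: "P * (M * P) = P" using N(2) by simp
  define R where "R = M * P * L"
  have R: "R \<in> carrier_mat c r" unfolding R_def using M P L by auto
  have PR: "P * R = P * L"
  proof -
    have MPc: "M * P \<in> carrier_mat c c" using M P by auto
    have "P * R = P * (M * P) * L" unfolding R_def by (rule assoc_mult_mat[symmetric, OF P MPc L(1)])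
    then show ?thesis unfolding PMP .
  qed
  have RP: "R * P = M * P"
  proof -
    have "R * P = M * (P * L * P)"
      unfolding R_def using carrier_matD[OF P] carrier_matD[OF M] carrier_matD[OF L(1)]
      by (simp add: mult_mat_assoc_dim)
    then show ?thesis unfolding L(2) .
  qed
  have "R * P * R = M * (P * R)" unfolding RP using M P R by simp
  also have "\<dots> = R" unfolding PR using M P L(1) by (simp add: R_def)
  finally have "R * P * R = R" .
  then show ?thesis unfolding is_pinv_def
    using R PR RP L sM by (intro exI[of _ R]) (auto simp: r_def c_def)
qed

text \<open>\<open>P * R\<close> and \<open>P * S\<close> are symmetric and each absorbs the other,
  so transposing one product shows them equal; likewise \<open>R * P = S * P\<close>. Then R = RPR =
  RPS = SPS = S.\<close>

lemma is_pinv_unique: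
  assumes "is_pinv P R" "is_pinv P S"
  shows "R = S"
proof -
  define r c where "r = dim_row P" and "c = dim_col P"
  have P: "P \<in> carrier_mat r c" unfolding r_def c_def by auto
  have R: "R \<in> carrier_mat c r" "P * R * P = P" "R * P * R = R" "(P * R)\<^sup>T = P * R" "(R * P)\<^sup>T = R * P"
   and S: "S \<in> carrier_mat c r" "P * S * P = P" "S * P * S = S" "(P * S)\<^sup>T = P * S" "(S * P)\<^sup>T = S * P"
    using assms unfolding is_pinv_def r_def c_def by auto
  have PR: "P * R \<in> carrier_mat r r" and PS: "P * S \<in> carrier_mat r r"
    and RP: "R * P \<in> carrier_mat c c" and SP: "S * P \<in> carrier_mat c c" using P R S by auto
  have "P * S * (P * R) = P * S * P * R"
    using P R(1) PS by (simp del: assoc_mult_mat add: assoc_mult_mat[symmetric, of "P * S" r r])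
  then have "P * S * (P * R) = P * R" unfolding S(2) .
  moreover have "P * R * (P * S) = P * R * P * S"
    using P S(1) PR by (simp del: assoc_mult_mat add: assoc_mult_mat[symmetric, of "P * R" r r])
  then have "P * R * (P * S) = P * S" unfolding R(2) .
  ultimately have 1: "P * R = P * S" using transpose_mult[OF PR PS] R(4) S(4) by simp
  have "R * P * (S * P) = R * (P * S * P)"
    using carrier_matD[OF P] carrier_matD[OF R(1)] carrier_matD[OF S(1)] by (simp add: mult_mat_assoc_dim)
  then have "R * P * (S * P) = R * P" unfolding S(2) .
  moreover have "S * P * (R * P) = S * (P * R * P)"
    using carrier_matD[OF P] carrier_matD[OF R(1)] carrier_matD[OF S(1)] by (simp add: mult_mat_assoc_dim)
  then have "S * P * (R * P) = S * P" unfolding R(2) .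
  ultimately have 2: "R * P = S * P" using transpose_mult[OF RP SP] R(5) S(5) by simp
  have "R = R * (P * R)" using R P by simp
  also have "\<dots> = R * P * S" unfolding 1 using R(1) S(1) P by simp
  also have "\<dots> = S" unfolding 2 using S by simp
  finally show ?thesis .
qed

lemma is_pinv_pinv: "is_pinv P (pinv P)"
  unfolding pinv_def using ex_is_pinv is_pinv_unique by (metis theI)

lemma
  assumes P: "P \<in> carrier_mat r c"
  shows pinv_carrier: "pinv P \<in> carrier_mat c r"
    and mult_pinv_mult: "P * pinv P * P = P"
    and transpose_mult_pinv: "(P * pinv P)\<^sup>T = P * pinv P"
  using is_pinv_pinv[of P] P unfolding is_pinv_def by auto

text \<open>A consistent system is solved exactly by the pseudoinverse. This is where reachability
  will enter, as consistency of the system with matrix \<open>H\<close>.\<close>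

lemma pinv_solves:
  assumes P: "P \<in> carrier_mat r c" and x: "x \<in> carrier_vec c"
  shows "P *\<^sub>v (pinv P *\<^sub>v (P *\<^sub>v x)) = P *\<^sub>v x"
proof -
  note c = pinv_carrier[OF P]
  have "P *\<^sub>v (pinv P *\<^sub>v (P *\<^sub>v x)) = (P * pinv P * P) *\<^sub>v x"
    using P c x by (simp add: assoc_mult_mat_vec[of _ r r] del: assoc_mult_mat)
  then show ?thesis unfolding mult_pinv_mult[OF P] .
qed

lemma mult_pinv_eq_one:
  assumes P: "P \<in> carrier_mat r c"
    and surj: "\<And>z. z \<in> carrier_vec r \<Longrightarrow> \<exists>x \<in> carrier_vec c. P *\<^sub>v x = z"
  shows "P * pinv P = 1\<^sub>m r"
proof (rule mat_eqI_mult_vec[of _ r r])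
  note c = pinv_carrier[OF P]
  show "P * pinv P \<in> carrier_mat r r" using P c by auto
  fix v :: "real vec" assume v: "v \<in> carrier_vec r"
  obtain x where x: "x \<in> carrier_vec c" "P *\<^sub>v x = v" using surj[OF v] by auto
  show "(P * pinv P) *\<^sub>v v = 1\<^sub>m r *\<^sub>v v"
    using pinv_solves[OF P x(1)] x v P c by simp
qed simp

subsection \<open>Kernel bases and full row rank\<close>

text \<open>Everything later uses only that the range of \<open>K\<close> is the kernel of
  \<open>P\<close>, so the choice of the basis is immaterial.\<close>

lemma kernel_basis_mat_kernel:
  assumes P: "P \<in> carrier_mat r c" and K: "kernel_basis_mat P K"
  shows "K \<in> carrier_mat c (dim_col K)"
    and "y \<in> carrier_vec (dim_col K) \<Longrightarrow> P *\<^sub>v (K *\<^sub>v y) = 0\<^sub>v r"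
    and "x \<in> carrier_vec c \<Longrightarrow> P *\<^sub>v x = 0\<^sub>v r \<Longrightarrow> \<exists>y \<in> carrier_vec (dim_col K). x = K *\<^sub>v y"
proof -
  interpret k: kernel r c P by (unfold_locales, rule P)
  show Kc: "K \<in> carrier_mat c (dim_col K)" using K carrier_matD(2)[OF P] unfolding kernel_basis_mat_def by blast
  have b: "k.basis (set (cols K))" using K unfolding kernel_basis_mat_def carrier_matD(2)[OF P] by blast
  then have sub: "set (cols K) \<subseteq> mat_kernel P" and sp: "k.span (set (cols K)) = mat_kernel P"
    unfolding k.Ker.basis_def by blast+
  \<comment> \<open>The basis lives in the kernel as a space of its own; its span has to be taken in
    the ambient space before it can be compared with the column space of \<open>K\<close>.\<close>
  have sp': "k.NC.span (set (cols K)) = mat_kernel P" using k.span_same[OF sub] sp by metis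
  have eq: "mat_kernel P = {y \<in> carrier_vec (dim_row K). \<exists>x\<in>carrier_vec (dim_col K). K *\<^sub>v x = y}"
    using k.NC.col_space_eq[OF Kc] unfolding k.NC.col_space_def sp' .
  show "P *\<^sub>v (K *\<^sub>v y) = 0\<^sub>v r" if "y \<in> carrier_vec (dim_col K)"
  proof -
    have "K *\<^sub>v y \<in> mat_kernel P" unfolding eq using that mult_mat_vec_carrier[OF Kc that] carrier_matD(1)[OF Kc] by blast
    then show ?thesis using mat_kernelD[OF P] by blast
  qed
  show "\<exists>y \<in> carrier_vec (dim_col K). x = K *\<^sub>v y" if "x \<in> carrier_vec c" "P *\<^sub>v x = 0\<^sub>v r"
  proof -
    have "x \<in> mat_kernel P" using mat_kernelI[OF P] that by blast
    then show ?thesis unfolding eq by blast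
  qed
qed

text \<open>A maximal independent set of columns has as many elements as the rank, here the
  dimension \<open>r\<close> of the target space, so it is a basis of that space and the columns
  span it.\<close>

lemma full_row_rank_surj:
  assumes P: "P \<in> carrier_mat r c" and full: "full_row_rank P" and z: "z \<in> carrier_vec r"
  shows "\<exists>x \<in> carrier_vec c. P *\<^sub>v x = z"
proof -
  interpret vec_space "TYPE(real)" r .
  let ?S = "set (cols P)"
  have rk: "rank P = r" using full unfolding full_row_rank_def carrier_matD(1)[OF P] .
  have S: "?S \<subseteq> carrier_vec r" using cols_dim[of P] unfolding carrier_matD(1)[OF P] .
  have fin: "finite ?S" by simp
  have "lin_indpt {}" unfolding lin_dep_def by blast
  then obtain U where U: "maximal U (\<lambda>T. T \<subseteq> ?S \<and> lin_indpt T)"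
    using maximal_exists_superset[of ?S "\<lambda>T. T \<subseteq> ?S \<and> lin_indpt T" "{}"] by blast
  have Ur: "card U = r" using rank_card_indpt[OF P U] rk by simp
  have Us: "U \<subseteq> ?S" "lin_indpt U" using U unfolding maximal_def by blast+
  have Uc: "U \<subseteq> carrier_vec r" using Us(1) S by blast
  have "basis U"
    by (rule dim_li_is_basis[OF fin_dim finite_subset[OF Us(1) fin] _ Us(2)]) (simp_all add: Uc Ur dim_is_n)
  then have "span U = carrier_vec r" unfolding basis_def by simp
  moreover have "span U \<subseteq> span ?S" using span_is_monotone[OF Us(1)] .
  ultimately have "z \<in> col_space P" unfolding col_space_def using z by blast
  then show ?thesis unfolding col_space_eq[OF P] using P by auto
qed

subsection \<open>Controllability matrix\<close>

text \<open>Powers are defined with the new factor on the right, whereas the dynamics multiply by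
  \<open>A\<close> on the left.\<close>

lemma pow_mat_Suc_left:
  assumes A: "A \<in> carrier_mat n n"
  shows "A ^\<^sub>m Suc t = A * A ^\<^sub>m t"
proof (induction t)
  case (Suc t)
  have At: "A ^\<^sub>m t \<in> carrier_mat n n" using A by simp
  have "A ^\<^sub>m Suc (Suc t) = A * A ^\<^sub>m t * A" using Suc by simp
  also have "\<dots> = A * (A ^\<^sub>m t * A)" by (rule assoc_mult_mat[OF A At A])
  finally show ?case by simp
qed (use A in simp)

lemma pow_mat_add:
  assumes A: "A \<in> carrier_mat n n"
  shows "A ^\<^sub>m (s + t) = A ^\<^sub>m s * A ^\<^sub>m t"
proof (induction t)
  case (Suc t)
  have c: "A ^\<^sub>m s \<in> carrier_mat n n" "A ^\<^sub>m t \<in> carrier_mat n n" using A by auto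
  show ?case using Suc assoc_mult_mat[OF c A] by simp
qed (use A in simp)

lemma block_row_carrier:
  assumes "\<And>P. P \<in> set Ps \<Longrightarrow> dim_row P = nr"
  shows "block_row nr Ps \<in> carrier_mat nr (sum_list (map dim_col Ps))"
  using assms unfolding block_row_def by (induction Ps) auto

lemma mult_block_row:
  fixes A :: "'a :: comm_semiring_1 mat"
  assumes A: "A \<in> carrier_mat q nr" and Ps: "\<And>P. P \<in> set Ps \<Longrightarrow> dim_row P = nr"
  shows "A * block_row nr Ps = block_row q (map ((*) A) Ps)"
  using Ps
proof (induction Ps)
  case Nil
  show ?case using A by (auto simp: block_row_def intro!: eq_matI)
next
  case (Cons P Ps)
  have "block_row nr Ps \<in> carrier_mat nr (sum_list (map dim_col Ps))"
    using Cons.prems by (intro block_row_carrier) auto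
  then have "A * append_cols P (block_row nr Ps) = append_cols (A * P) (A * block_row nr Ps)"
    by (intro mult_append_cols[OF A, of _ "dim_col P"]) (use Cons.prems[of P] in auto)
  then show ?case using Cons by (simp add: block_row_def)
qed

lemma ctrb_carrier:
  assumes A: "A \<in> carrier_mat n n" and B: "B \<in> carrier_mat n m"
  shows "ctrb A B t \<in> carrier_mat n (m * t)"
proof -
  have e: "map dim_col (map (\<lambda>t. A ^\<^sub>m t * B) [0..<t]) = map (\<lambda>_. m) [0..<t]" using B by auto
  have "sum_list (map dim_col (map (\<lambda>t. A ^\<^sub>m t * B) [0..<t])) = m * t"
    unfolding e by (simp add: sum_list_triv)
  moreover have "block_row n (map (\<lambda>t. A ^\<^sub>m t * B) [0..<t])
      \<in> carrier_mat n (sum_list (map dim_col (map (\<lambda>t. A ^\<^sub>m t * B) [0..<t])))"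
    by (rule block_row_carrier) (use A in auto)
  ultimately show ?thesis unfolding ctrb_def using carrier_matD(1)[OF A] by simp
qed

text \<open>In reversed time order the first block belongs to the last input, which acts through
  \<open>B\<close> alone; all earlier inputs pass through \<open>A\<close> once more.\<close>

lemma ctrb_Suc:
  assumes A: "A \<in> carrier_mat n n" and B: "B \<in> carrier_mat n m"
  shows "ctrb A B (Suc t) = append_cols B (A * ctrb A B t)"
proof -
  have dA: "dim_row A = n" using A by simp
  have "map (\<lambda>t. A ^\<^sub>m t * B) [0..<Suc t] = B # map ((*) A) (map (\<lambda>t. A ^\<^sub>m t * B) [0..<t])"
  proof (rule nth_equalityI)
    fix i assume i: "i < length (map (\<lambda>t. A ^\<^sub>m t * B) [0..<Suc t])"
    have c: "A ^\<^sub>m k \<in> carrier_mat n n" for k using A by simp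
    show "map (\<lambda>t. A ^\<^sub>m t * B) [0..<Suc t] ! i = (B # map ((*) A) (map (\<lambda>t. A ^\<^sub>m t * B) [0..<t])) ! i"
    proof (cases i)
      case 0
      then show ?thesis using A B by (simp del: upt_Suc)
    next
      case (Suc k)
      then show ?thesis using i assoc_mult_mat[OF A c[of k] B] pow_mat_Suc_left[OF A, of k]
        by (simp del: upt_Suc pow_mat.simps)
    qed
  qed simp
  then have "ctrb A B (Suc t) = append_cols B (block_row n (map ((*) A) (map (\<lambda>t. A ^\<^sub>m t * B) [0..<t])))"
    unfolding ctrb_def dA by (simp add: block_row_def)
  also have "block_row n (map ((*) A) (map (\<lambda>t. A ^\<^sub>m t * B) [0..<t])) = A * ctrb A B t"
    unfolding ctrb_def dA by (rule mult_block_row[OF A, symmetric]) (use A in auto)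
  finally show ?thesis .
qed

text \<open>The leading \<open>s\<close> blocks belong to the last \<open>s\<close> inputs. The
  effect of the \<open>t\<close> inputs before them is carried along by the \<open>s\<close>-th
  power of \<open>A\<close>.\<close>

lemma ctrb_add:
  assumes A: "A \<in> carrier_mat n n" and B: "B \<in> carrier_mat n m"
  shows "ctrb A B (s + t) = append_cols (ctrb A B s) (A ^\<^sub>m s * ctrb A B t)"
proof (induction s)
  case 0
  have "ctrb A B 0 = 0\<^sub>m n 0" using A by (simp add: ctrb_def block_row_def)
  then show ?case using A ctrb_carrier[OF A B, of t] by simp
next
  case (Suc s)
  have As: "A ^\<^sub>m s \<in> carrier_mat n n" using A by simp
  note c = ctrb_carrier[OF A B]
  have assoc: "A * (A ^\<^sub>m s * ctrb A B t) = A ^\<^sub>m Suc s * ctrb A B t"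
    unfolding pow_mat_Suc_left[OF A] by (rule assoc_mult_mat[OF A As c, symmetric])
  have "A * ctrb A B (s + t) = append_cols (A * ctrb A B s) (A ^\<^sub>m Suc s * ctrb A B t)"
    unfolding Suc by (rule mult_append_cols[OF A c mult_carrier_mat[OF As c], THEN trans]) (simp add: assoc)
  then have "ctrb A B (Suc s + t) = append_cols B (append_cols (A * ctrb A B s) (A ^\<^sub>m Suc s * ctrb A B t))"
    using ctrb_Suc[OF A B] by simp
  then show ?case unfolding ctrb_Suc[OF A B, of s] using A B by (simp add: append_cols_assoc del: pow_mat.simps)
qed

lemma state_cong:
  "(\<And>s. s < t \<Longrightarrow> u s = u' s) \<Longrightarrow> state A B x u t = state A B x u' t"
  by (induction t) auto

lemma state_eq_ctrb:
  assumes A: "A \<in> carrier_mat n n" and B: "B \<in> carrier_mat n m"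
    and x: "x \<in> carrier_vec n" and v: "v \<in> carrier_vec (m * t)"
  shows "state A B x (input_at m t v) t = A ^\<^sub>m t *\<^sub>v x + ctrb A B t *\<^sub>v v"
  using v
proof (induction t arbitrary: v)
  case 0
  have "ctrb A B 0 = 0\<^sub>m n 0" using A by (simp add: ctrb_def block_row_def)
  then show ?case using A x 0 by (intro eq_vecI) (auto simp: scalar_prod_def)
next
  case (Suc t)
  \<comment> \<open>\<open>w\<close> is the input at the last time \<open>t\<close>, and
    \<open>z\<close> stacks the inputs at the earlier times.\<close>
  define w z where "w = vec_first v m" and "z = vec_last v (m * t)"
  have w: "w \<in> carrier_vec m" and z: "z \<in> carrier_vec (m * t)" and v: "v = w @\<^sub>v z"
    using Suc.prems unfolding w_def z_def by auto
  have At: "A ^\<^sub>m t \<in> carrier_mat n n" using A by simp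
  note c = ctrb_carrier[OF A B]
  \<comment> \<open>The input at time \<open>s\<close> is block \<open>t - s\<close> of
    \<open>v\<close> but block \<open>t - 1 - s\<close> of \<open>z\<close>; the shift by one block
    is the length \<open>m\<close> of \<open>w\<close>.\<close>
  have iz: "input_at m (Suc t) v s = input_at m t z s" if st: "s < t" for s
  proof (rule eq_vecI)
    fix j assume "j < dim_vec (input_at m t z s)"
    then have j: "j < m" by (simp add: input_at_def)
    obtain k where k: "t - s = Suc k" "t - 1 - s = k" using st by (cases "t - s") auto
    have e: "(t - s) * m + j = m + ((t - 1 - s) * m + j)" using k by simp
    have "(t - 1 - s) * m + j < (t - 1 - s) * m + m" using j by simp
    also have "\<dots> = (t - s) * m" using k by simp
    also have "\<dots> \<le> m * t" by simp
    finally have "(t - 1 - s) * m + j < m * t" .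
    then have "v $ ((t - s) * m + j) = z $ ((t - 1 - s) * m + j)"
      unfolding v e using w z by simp
    then show "input_at m (Suc t) v s $ j = input_at m t z s $ j" using j by (simp add: input_at_def)
  qed (simp add: input_at_def)
  have iw: "input_at m (Suc t) v t = w"
    unfolding v using w by (intro eq_vecI) (auto simp: input_at_def)
  have "state A B x (input_at m (Suc t) v) t = A ^\<^sub>m t *\<^sub>v x + ctrb A B t *\<^sub>v z"
    using state_cong[OF iz] Suc.IH[OF z] by simp
  then have "state A B x (input_at m (Suc t) v) (Suc t) = A *\<^sub>v (A ^\<^sub>m t *\<^sub>v x + ctrb A B t *\<^sub>v z) + B *\<^sub>v w"
    using iw by simp
  also have "A *\<^sub>v (A ^\<^sub>m t *\<^sub>v x + ctrb A B t *\<^sub>v z) = A ^\<^sub>m Suc t *\<^sub>v x + (A * ctrb A B t) *\<^sub>v z"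
    using assoc_mult_mat_vec[OF A At x] assoc_mult_mat_vec[OF A c z] pow_mat_Suc_left[OF A, of t]
    by (subst mult_add_distrib_mat_vec[OF A]) (use mult_mat_vec_carrier[OF At x] mult_mat_vec_carrier[OF c z] in simp_all)
  also have "\<dots> + B *\<^sub>v w = A ^\<^sub>m Suc t *\<^sub>v x + (B *\<^sub>v w + (A * ctrb A B t) *\<^sub>v z)"
    using A B c z w x by (intro eq_vecI) auto
  also have "B *\<^sub>v w + (A * ctrb A B t) *\<^sub>v z = ctrb A B (Suc t) *\<^sub>v v"
    unfolding v ctrb_Suc[OF A B]
    by (rule append_cols_mult_vec[symmetric, OF B _ w z]) (use A c in auto)
  finally show ?case .
qed

subsection \<open>Experiments\<close>

lemma experiments_eq:
  assumes A: "A \<in> carrier_mat n n" and B: "B \<in> carrier_mat n m" and ex: "experiments A B t N U X0 X"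
  shows "X = A ^\<^sub>m t * X0 + ctrb A B t * U"
proof (rule mat_col_eqI)
  have U: "U \<in> carrier_mat (m * t) N" and X0: "X0 \<in> carrier_mat n N" and X: "X \<in> carrier_mat n N"
    and cX: "\<And>j. j < N \<Longrightarrow> col X j = state A B (col X0 j) (input_at m t (col U j)) t"
    using ex A B unfolding experiments_def by auto
  note C = ctrb_carrier[OF A B, of t]
  have At: "A ^\<^sub>m t \<in> carrier_mat n n" using A by simp
  show "dim_row X = dim_row (A ^\<^sub>m t * X0 + ctrb A B t * U)"
    "dim_col X = dim_col (A ^\<^sub>m t * X0 + ctrb A B t * U)" using X C U by auto
  fix j assume "j < dim_col (A ^\<^sub>m t * X0 + ctrb A B t * U)"
  then have j: "j < N" using U by simp
  have "col X0 j \<in> carrier_vec n" "col U j \<in> carrier_vec (m * t)" using X0 U j by auto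
  then have "col X j = A ^\<^sub>m t *\<^sub>v col X0 j + ctrb A B t *\<^sub>v col U j"
    unfolding cX[OF j] by (rule state_eq_ctrb[OF A B])
  also have "\<dots> = col (A ^\<^sub>m t * X0 + ctrb A B t * U) j"
    using j col_mult2[OF At X0 j] col_mult2[OF C U j] At X0 C U by (subst col_add) auto
  finally show "col X j = col (A ^\<^sub>m t * X0 + ctrb A B t * U) j" .
qed

lemma experiments_mult_vec:
  assumes A: "A \<in> carrier_mat n n" and B: "B \<in> carrier_mat n m" and ex: "experiments A B t N U X0 X"
    and w: "w \<in> carrier_vec N"
  shows "X *\<^sub>v w = A ^\<^sub>m t *\<^sub>v (X0 *\<^sub>v w) + ctrb A B t *\<^sub>v (U *\<^sub>v w)"
proof -
  have U: "U \<in> carrier_mat (m * t) N" and X0: "X0 \<in> carrier_mat n N"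
    using ex A B unfolding experiments_def by auto
  note C = ctrb_carrier[OF A B, of t]
  have At: "A ^\<^sub>m t \<in> carrier_mat n n" using A by simp
  have "X *\<^sub>v w = (A ^\<^sub>m t * X0) *\<^sub>v w + (ctrb A B t * U) *\<^sub>v w"
    unfolding experiments_eq[OF A B ex] using At X0 C U w
    by (intro add_mult_distrib_mat_vec) auto
  then show ?thesis using assoc_mult_mat_vec[OF At X0 w] assoc_mult_mat_vec[OF C U w] by simp
qed

text \<open>With \<open>P\<close> the initial states and \<open>R\<close> the inputs,
  \<open>w\<close> is the combination of experiments that realizes a prescribed pair.\<close>

lemma append_rows_surj:
  assumes P: "P \<in> carrier_mat r N" and R: "R \<in> carrier_mat s N" and full: "full_row_rank (P @\<^sub>r R)"
    and x: "x \<in> carrier_vec r" and y: "y \<in> carrier_vec s"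
  obtains w where "w \<in> carrier_vec N" "P *\<^sub>v w = x" "R *\<^sub>v w = y"
proof -
  have "P @\<^sub>r R \<in> carrier_mat (r + s) N" using P R by simp
  from full_row_rank_surj[OF this full, of "x @\<^sub>v y"] x y
  obtain w where w: "w \<in> carrier_vec N" "(P @\<^sub>r R) *\<^sub>v w = x @\<^sub>v y" by auto
  then have "P *\<^sub>v w @\<^sub>v R *\<^sub>v w = x @\<^sub>v y" using mat_mult_append[OF P R w(1)] by simp
  then have "P *\<^sub>v w = x \<and> R *\<^sub>v w = y"
    by (subst (asm) append_vec_eq[of _ r]) (use P w x in auto)
  then show ?thesis using that w by auto
qed

text \<open>The preimage \<open>w\<close> lies in the kernel of \<open>R\<close>, so it factors
  through \<open>K\<close>. Initial states and inputs take the roles of \<open>P\<close> and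
  \<open>R\<close> in both orders.\<close>

lemma mult_kernel_basis_surj:
  assumes P: "P \<in> carrier_mat r N" and R: "R \<in> carrier_mat s N" and K: "kernel_basis_mat R K"
    and onto: "\<exists>w \<in> carrier_vec N. P *\<^sub>v w = x \<and> R *\<^sub>v w = 0\<^sub>v s"
  shows "\<exists>y \<in> carrier_vec (dim_col K). (P * K) *\<^sub>v y = x"
proof -
  obtain w where w: "w \<in> carrier_vec N" "P *\<^sub>v w = x" "R *\<^sub>v w = 0\<^sub>v s" using onto by auto
  note k = kernel_basis_mat_kernel[OF R K]
  obtain y where y: "y \<in> carrier_vec (dim_col K)" "w = K *\<^sub>v y" using k(3)[OF w(1,3)] by auto
  then show ?thesis using w(2) assoc_mult_mat_vec[OF P k(1) y(1)] by auto
qed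

text \<open>Columns of \<open>K\<close> combine experiments so that the initial states cancel; by
  linearity only the forced response remains.\<close>

lemma zero_state_experiments:
  assumes A: "A \<in> carrier_mat n n" and B: "B \<in> carrier_mat n m" and ex: "experiments A B t N U X0 X"
    and K: "kernel_basis_mat X0 K"
  shows "X * K = ctrb A B t * (U * K)"
proof (rule mat_eqI_mult_vec[of _ n "dim_col K"])
  have U: "U \<in> carrier_mat (m * t) N" and X0: "X0 \<in> carrier_mat n N" and X: "X \<in> carrier_mat n N"
    using ex A B unfolding experiments_def by auto
  note C = ctrb_carrier[OF A B, of t]
  have At: "A ^\<^sub>m t \<in> carrier_mat n n" using A by simp
  note k = kernel_basis_mat_kernel[OF X0 K]
  have UK: "U * K \<in> carrier_mat (m * t) (dim_col K)" by (rule mult_carrier_mat[OF U k(1)])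
  show "X * K \<in> carrier_mat n (dim_col K)" "ctrb A B t * (U * K) \<in> carrier_mat n (dim_col K)"
    by (rule mult_carrier_mat[OF X k(1)], rule mult_carrier_mat[OF C UK])
  fix v :: "real vec" assume v: "v \<in> carrier_vec (dim_col K)"
  have Kv: "K *\<^sub>v v \<in> carrier_vec N" by (rule mult_mat_vec_carrier[OF k(1) v])
  have "(X * K) *\<^sub>v v = A ^\<^sub>m t *\<^sub>v 0\<^sub>v n + ctrb A B t *\<^sub>v (U *\<^sub>v (K *\<^sub>v v))"
    using assoc_mult_mat_vec[OF X k(1) v] experiments_mult_vec[OF A B ex Kv] k(2)[OF v] by simp
  also have "\<dots> = ctrb A B t *\<^sub>v (U *\<^sub>v (K *\<^sub>v v))"
    unfolding mult_mat_zero_vec[OF At] using U Kv by (intro left_zero_vec mult_mat_vec_carrier[OF C]) auto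
  also have "\<dots> = (ctrb A B t * (U * K)) *\<^sub>v v"
    using assoc_mult_mat_vec[OF C UK v] assoc_mult_mat_vec[OF U k(1) v] by simp
  finally show "(X * K) *\<^sub>v v = (ctrb A B t * (U * K)) *\<^sub>v v" .
qed

text \<open>Now the inputs cancel, leaving the free response: \<open>X * K\<close> is the power of
  \<open>A\<close> times \<open>X0 * K\<close>. Full row rank makes \<open>X0 * K\<close> onto, so
  its pseudoinverse is a right inverse and cancels it.\<close>

lemma zero_input_experiments:
  assumes A: "A \<in> carrier_mat n n" and B: "B \<in> carrier_mat n m" and ex: "experiments A B t N U X0 X"
    and K: "kernel_basis_mat U K" and full: "full_row_rank (X0 @\<^sub>r U)"
  shows "X * K * pinv (X0 * K) = A ^\<^sub>m t"
proof -
  have U: "U \<in> carrier_mat (m * t) N" and X0: "X0 \<in> carrier_mat n N" and X: "X \<in> carrier_mat n N"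
    using ex A B unfolding experiments_def by auto
  note C = ctrb_carrier[OF A B, of t]
  have At: "A ^\<^sub>m t \<in> carrier_mat n n" using A by simp
  note k = kernel_basis_mat_kernel[OF U K]
  have X0K: "X0 * K \<in> carrier_mat n (dim_col K)" by (rule mult_carrier_mat[OF X0 k(1)])
  note p = pinv_carrier[OF X0K]
  have XK: "X * K = A ^\<^sub>m t * (X0 * K)"
  proof (rule mat_eqI_mult_vec[of _ n "dim_col K"])
    show "X * K \<in> carrier_mat n (dim_col K)" "A ^\<^sub>m t * (X0 * K) \<in> carrier_mat n (dim_col K)"
      by (rule mult_carrier_mat[OF X k(1)], rule mult_carrier_mat[OF At X0K])
    fix v :: "real vec" assume v: "v \<in> carrier_vec (dim_col K)"
    have Kv: "K *\<^sub>v v \<in> carrier_vec N" by (rule mult_mat_vec_carrier[OF k(1) v])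
    have "(X * K) *\<^sub>v v = A ^\<^sub>m t *\<^sub>v (X0 *\<^sub>v (K *\<^sub>v v)) + ctrb A B t *\<^sub>v 0\<^sub>v (m * t)"
      using assoc_mult_mat_vec[OF X k(1) v] experiments_mult_vec[OF A B ex Kv] k(2)[OF v] by simp
    also have "\<dots> = A ^\<^sub>m t *\<^sub>v (X0 *\<^sub>v (K *\<^sub>v v))"
      unfolding mult_mat_zero_vec[OF C] using X0 Kv by (intro right_zero_vec mult_mat_vec_carrier[OF At]) auto
    also have "\<dots> = (A ^\<^sub>m t * (X0 * K)) *\<^sub>v v"
      using assoc_mult_mat_vec[OF At X0K v] assoc_mult_mat_vec[OF X0 k(1) v] by simp
    finally show "(X * K) *\<^sub>v v = (A ^\<^sub>m t * (X0 * K)) *\<^sub>v v" .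
  qed
  have "X0 * K * pinv (X0 * K) = 1\<^sub>m n"
  proof (rule mult_pinv_eq_one[OF X0K])
    fix z :: "real vec" assume z: "z \<in> carrier_vec n"
    show "\<exists>x \<in> carrier_vec (dim_col K). (X0 * K) *\<^sub>v x = z"
      using append_rows_surj[OF X0 U full z zero_carrier_vec]
      by (intro mult_kernel_basis_surj[OF X0 U K]) metis
  qed
  then show ?thesis unfolding XK assoc_mult_mat[OF At X0K p] using right_mult_one_mat[OF At] by simp
qed

subsection \<open>Concatenation of horizons\<close>

lemma Q_prod_Suc:
  assumes "i \<le> Suc l"
  shows "Q_prod n (Suc l) Q i = Q (Suc l) * Q_prod n l Q i"
  using assms unfolding Q_prod_def by simp

lemma Q_prod_empty: "Q_prod n l Q (Suc l) = 1\<^sub>m n"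
  unfolding Q_prod_def by simp

lemma Q_prod_carrier:
  assumes "\<And>i. i \<in> {j..l} \<Longrightarrow> Q i \<in> carrier_mat n n"
  shows "Q_prod n l Q j \<in> carrier_mat n n"
proof -
  \<comment> \<open>Generalized to any list of admissible indices, so that induction can remove the
    head.\<close>
  have "foldr (*) (map Q xs) (1\<^sub>m n) \<in> carrier_mat n n" if "set xs \<subseteq> {j..l}" for xs
    using that
  proof (induction xs)
    case (Cons i xs)
    then show ?case using mult_carrier_mat[of "Q i" n n] assms[of i] by simp
  qed simp
  from this[of "rev [j..<Suc l]"] show ?thesis unfolding Q_prod_def by (simp del: upt_Suc add: subset_iff)
qed

lemma block_diag_surj:
  assumes "\<And>P. P \<in> set Ps \<Longrightarrow> \<forall>z \<in> carrier_vec (dim_row P). \<exists>x \<in> carrier_vec (dim_col P). P *\<^sub>v x = z"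
  shows "\<forall>z \<in> carrier_vec (dim_row (diag_block_mat Ps)).
    \<exists>x \<in> carrier_vec (dim_col (diag_block_mat Ps)). diag_block_mat Ps *\<^sub>v x = (z :: 'a :: comm_semiring_1 vec)"
  using assms
proof (induction Ps)
  case Nil
  show ?case by (intro ballI bexI[of _ "0\<^sub>v 0"]) auto
next
  case (Cons P Ps)
  let ?D = "diag_block_mat Ps"
  show ?case
  proof
    fix z :: "'a vec" assume "z \<in> carrier_vec (dim_row (diag_block_mat (P # Ps)))"
    then have "z \<in> carrier_vec (dim_row P + dim_row ?D)" by (simp add: Let_def)
    then obtain z1 z2 where z: "z = z1 @\<^sub>v z2" "z1 \<in> carrier_vec (dim_row P)" "z2 \<in> carrier_vec (dim_row ?D)"
      by (rule append_vec_split)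
    obtain x1 where x1: "x1 \<in> carrier_vec (dim_col P)" "P *\<^sub>v x1 = z1" using Cons.prems[of P] z by auto
    obtain x2 where x2: "x2 \<in> carrier_vec (dim_col ?D)" "?D *\<^sub>v x2 = z2" using Cons z by auto
    have "diag_block_mat (P # Ps) *\<^sub>v (x1 @\<^sub>v x2) = z"
      unfolding z(1) diag_block_mat.simps Let_def using x1 x2 z
      by (subst four_block_mat_mult_vec[of _ "dim_row P" "dim_col P" _ "dim_col ?D" _ "dim_row ?D"]) auto
    then show "\<exists>x \<in> carrier_vec (dim_col (diag_block_mat (P # Ps))). diag_block_mat (P # Ps) *\<^sub>v x = z"
      using x1 x2 by (intro bexI[of _ "x1 @\<^sub>v x2"]) (auto simp: Let_def)
  qed
qed

text \<open>Induction on the number of horizons. A further horizon comes last in time, hence first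
  in the block order: it contributes a new leading block and multiplies everything older from the
  left by \<open>Q (Suc l)\<close>, which matches the recursion \<open>ctrb_add\<close>.\<close>

lemma concatenated_blocks:
  assumes A: "A \<in> carrier_mat n n" and B: "B \<in> carrier_mat n m"
    and Ut: "\<And>i. i \<in> {1..l} \<Longrightarrow> dim_row (Ut i) = m * \<tau> i"
    and Xt: "\<And>i. i \<in> {1..l} \<Longrightarrow> Xt i = ctrb A B (\<tau> i) * Ut i"
    and Q: "\<And>i. i \<in> {1..l} \<Longrightarrow> Q i = A ^\<^sub>m \<tau> i"
  shows "dim_row (diag_block_mat (map Ut (rev [1..<Suc l]))) = m * (\<Sum>i = 1..l. \<tau> i)"
    and "block_row n (map (\<lambda>i. Q_prod n l Q (Suc i) * Xt i) (rev [1..<Suc l]))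
      = ctrb A B (\<Sum>i = 1..l. \<tau> i) * diag_block_mat (map Ut (rev [1..<Suc l]))"
    and "Q_prod n l Q 1 = A ^\<^sub>m (\<Sum>i = 1..l. \<tau> i)"
  using Ut Xt Q
proof (induction l)
  case 0
  {
    case 1 then show ?case by simp
  next
    case 2
    have "ctrb A B 0 = 0\<^sub>m n 0" using A by (simp add: ctrb_def block_row_def)
    then show ?case by (simp add: block_row_def)
  next
    case 3 then show ?case using A by (simp add: Q_prod_empty)
  }
next
  case (Suc l)
  let ?D = "diag_block_mat (map Ut (rev [1..<Suc l]))" and ?S = "\<Sum>i = 1..l. \<tau> i"
  let ?U = "Ut (Suc l)" and ?t = "\<tau> (Suc l)"
  let ?R = "block_row n (map (\<lambda>i. Q_prod n l Q (Suc i) * Xt i) (rev [1..<Suc l]))"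
  note c = ctrb_carrier[OF A B]
  have upt: "rev [i..<Suc (Suc l)] = Suc l # rev [i..<Suc l]" if "i \<le> Suc l" for i using that by simp
  have S: "(\<Sum>i = 1..Suc l. \<tau> i) = ?t + ?S" by simp
  have diag: "diag_block_mat (map Ut (rev [1..<Suc (Suc l)]))
      = four_block_mat ?U (0\<^sub>m (dim_row ?U) (dim_col ?D)) (0\<^sub>m (dim_row ?D) (dim_col ?U)) ?D"
    by (subst upt) (simp_all add: Let_def)
  {
    case 1
    have "dim_row ?D = m * ?S" by (rule Suc.IH(1)) (use 1 in auto)
    then show ?case unfolding diag S using 1(1)[of "Suc l"] by (simp add: algebra_simps)
  next
    case 2
    have D: "?D \<in> carrier_mat (m * ?S) (dim_col ?D)"
      using Suc.IH(1) 2 by (intro carrier_matI) auto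
    have R: "?R = ctrb A B ?S * ?D" by (rule Suc.IH(2)) (use 2 in auto)
    have U: "?U \<in> carrier_mat (m * ?t) (dim_col ?U)" using 2(1)[of "Suc l"] by auto
    have At: "A ^\<^sub>m ?t \<in> carrier_mat n n" using A by simp
    have Qc: "Q i \<in> carrier_mat n n" if "i \<in> {1..Suc l}" for i using 2(3)[OF that] A by simp
    have Xr: "dim_row (Xt i) = n" if "i \<in> {1..Suc l}" for i using 2(2)[OF that] A by (simp add: carrier_matD(1)[OF c])
    have Xc: "Xt i \<in> carrier_mat n (dim_col (Xt i))" if "i \<in> {1..Suc l}" for i using Xr[OF that] by auto
    have Qp: "Q_prod n l Q (Suc i) \<in> carrier_mat n n" for i
      by (rule Q_prod_carrier) (use Qc in auto)
    \<comment> \<open>All blocks but the leading one share the left factor \<open>Q (Suc l)\<close>;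
      what remains is the block row of the induction hypothesis.\<close>
    have Q_out: "map (\<lambda>i. Q_prod n (Suc l) Q (Suc i) * Xt i) (rev [1..<Suc l])
        = map ((*) (Q (Suc l))) (map (\<lambda>i. Q_prod n l Q (Suc i) * Xt i) (rev [1..<Suc l]))"
      unfolding map_map
    proof (rule map_cong[OF refl])
      fix i assume "i \<in> set (rev [1..<Suc l])"
      then have i: "i \<in> {1..Suc l}" "Suc i \<le> Suc l" by auto
      show "Q_prod n (Suc l) Q (Suc i) * Xt i = ((*) (Q (Suc l)) \<circ> (\<lambda>i. Q_prod n l Q (Suc i) * Xt i)) i"
        unfolding Q_prod_Suc[OF i(2)] o_def by (rule assoc_mult_mat[OF Qc Qp Xc[OF i(1)]]) simp
    qed
    have row: "block_row n (map f (rev [1..<Suc (Suc l)])) = append_cols (f (Suc l)) (block_row n (map f (rev [1..<Suc l])))" for f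
      by (subst upt) (simp_all add: block_row_def del: upt_Suc)
    \<comment> \<open>The leading block carries the empty product.\<close>
    have last: "Q_prod n (Suc l) Q (Suc (Suc l)) * Xt (Suc l) = Xt (Suc l)"
      using Xc[of "Suc l"] by (simp add: Q_prod_empty)
    have "block_row n (map (\<lambda>i. Q_prod n (Suc l) Q (Suc i) * Xt i) (rev [1..<Suc (Suc l)]))
        = append_cols (Xt (Suc l)) (block_row n (map ((*) (Q (Suc l))) (map (\<lambda>i. Q_prod n l Q (Suc i) * Xt i) (rev [1..<Suc l]))))"
      unfolding row last Q_out ..
    also have "block_row n (map ((*) (Q (Suc l))) (map (\<lambda>i. Q_prod n l Q (Suc i) * Xt i) (rev [1..<Suc l])))
        = Q (Suc l) * ?R"
      by (rule mult_block_row[OF Qc, symmetric]) (use carrier_matD(1)[OF Qp] in auto)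
    also have "\<dots> = A ^\<^sub>m ?t * ctrb A B ?S * ?D"
      unfolding R using 2(3)[of "Suc l"] assoc_mult_mat[OF At c D] by simp
    also have "append_cols (Xt (Suc l)) \<dots> = append_cols (ctrb A B ?t) (A ^\<^sub>m ?t * ctrb A B ?S)
        * four_block_mat ?U (0\<^sub>m (m * ?t) (dim_col ?D)) (0\<^sub>m (m * ?S) (dim_col ?U)) ?D"
      using append_cols_mult_block_diag[OF c _ U D, where R = "A ^\<^sub>m ?t * ctrb A B ?S"] 2(2)[of "Suc l"] At c
      by simp
    also have "\<dots> = ctrb A B (\<Sum>i = 1..Suc l. \<tau> i) * diag_block_mat (map Ut (rev [1..<Suc (Suc l)]))"
      unfolding diag S ctrb_add[OF A B] using carrier_matD(1)[OF U] carrier_matD(1)[OF D] by simp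
    finally show ?case .
  next
    case 3
    have "Q_prod n l Q 1 = A ^\<^sub>m ?S" by (rule Suc.IH(3)) (use 3 in auto)
    then show ?case unfolding S pow_mat_add[OF A] using Q_prod_Suc[of 1 l n Q] 3(3)[of "Suc l"] by simp
  }
qed

subsection \<open>Minimum-energy control\<close>

text \<open>The steering inputs are \<open>v + Ker C\<close>, so Pythagoras makes \<open>v\<close> the shortest one.\<close>
lemma orthogonal_min_energy:
  assumes A: "A \<in> carrier_mat n n" and B: "B \<in> carrier_mat n m" and x0: "x0 \<in> carrier_vec n"
    and v: "v \<in> carrier_vec (m * T)" and sol: "A ^\<^sub>m T *\<^sub>v x0 + ctrb A B T *\<^sub>v v = xf"
    and orth: "\<And>w. w \<in> carrier_vec (m * T) \<Longrightarrow> ctrb A B T *\<^sub>v w = 0\<^sub>v n \<Longrightarrow> w \<bullet> v = 0"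
  shows "min_energy_control A B T x0 xf v"
proof -
  note C = ctrb_carrier[OF A B, of T]
  have At: "A ^\<^sub>m T \<in> carrier_mat n n" using A by simp
  have st: "steers A B T x0 xf w \<longleftrightarrow>
      w \<in> carrier_vec (m * T) \<and> A ^\<^sub>m T *\<^sub>v x0 + ctrb A B T *\<^sub>v w = xf" for w
    unfolding steers_def using B state_eq_ctrb[OF A B x0] by auto
  \<comment> \<open>An exact identity, not just an inequality: the remainder gives minimality by its
    sign and uniqueness by its vanishing.\<close>
  have key: "w \<bullet> w = v \<bullet> v + (w - v) \<bullet> (w - v)" if "steers A B T x0 xf w" for w
  proof -
    have w: "w \<in> carrier_vec (m * T)" and e: "A ^\<^sub>m T *\<^sub>v x0 + ctrb A B T *\<^sub>v w = xf"
      using that unfolding st by auto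
    define d where "d = w - v"
    have d: "d \<in> carrier_vec (m * T)" unfolding d_def using w v by auto
    have "ctrb A B T *\<^sub>v d = ctrb A B T *\<^sub>v w - ctrb A B T *\<^sub>v v"
      unfolding d_def by (rule mult_minus_distrib_mat_vec[OF C w v])
    also have "\<dots> = 0\<^sub>v n"
    proof (rule eq_vecI)
      fix i assume i: "i < dim_vec (0\<^sub>v n :: real vec)"
      have "(A ^\<^sub>m T *\<^sub>v x0 + ctrb A B T *\<^sub>v w) $ i = (A ^\<^sub>m T *\<^sub>v x0 + ctrb A B T *\<^sub>v v) $ i"
        using e sol by simp
      then show "(ctrb A B T *\<^sub>v w - ctrb A B T *\<^sub>v v) $ i = 0\<^sub>v n $ i"
        using i C At by (simp del: index_mult_mat_vec)
    qed (use C in auto)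
    finally have "d \<bullet> v = 0" by (rule orth[OF d])
    moreover have "v \<bullet> d = d \<bullet> v" by (rule comm_scalar_prod[OF v d])
    moreover have "w = v + d" unfolding d_def using v w by (intro eq_vecI) auto
    ultimately show ?thesis unfolding d_def[symmetric] using v d
      by (simp add: add_scalar_prod_distrib[of _ "m * T"] scalar_prod_add_distrib[of _ "m * T"])
  qed
  have nn: "0 \<le> d \<bullet> d" for d :: "real vec" unfolding scalar_prod_def by (intro sum_nonneg) simp
  have sv: "steers A B T x0 xf v" unfolding st using v sol by auto
  show ?thesis unfolding min_energy_control_def
  proof (intro conjI allI impI)
    show "is_arg_min (\<lambda>w. w \<bullet> w) (steers A B T x0 xf) v"
      unfolding is_arg_min_def using sv key nn by (metis add.commute le_add_same_cancel2 not_le)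
    fix w assume "is_arg_min (\<lambda>w. w \<bullet> w) (steers A B T x0 xf) w"
    then have sw: "steers A B T x0 xf w" and "\<not> v \<bullet> v < w \<bullet> w"
      unfolding is_arg_min_def using sv by auto
    then have "(w - v) \<bullet> (w - v) = 0" using key[OF sw] nn[of "w - v"] by linarith
    then have z: "w - v = 0\<^sub>v (m * T)" using scalar_prod_self_eq_0 v by fastforce
    have w: "w \<in> carrier_vec (m * T)" using sw st by auto
    show "w = v"
    proof (rule eq_vecI)
      fix i assume "i < dim_vec v"
      then show "w $ i = v $ i" using arg_cong[OF z, of "\<lambda>x. x $ i"] v w by simp
    qed (use v w in auto)
  qed
qed

text \<open>The linear algebra of the formula, with \<open>F\<close> in the role of the
  \<open>T\<close>-th power of \<open>A\<close>. On a split vector \<open>(a, z)\<close>,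
  \<open>H\<close> returns \<open>(z, C D a + F z)\<close> and \<open>G\<close> returns
  \<open>D a\<close>. So solutions of \<open>H s = (x0, xf)\<close> are encodings of steering
  inputs, and kernel vectors of \<open>H\<close> are encodings of elements of the kernel of
  \<open>C\<close>.\<close>

lemma projected_solution:
  fixes C D F Kb :: "real mat"
  assumes C: "C \<in> carrier_mat n p" and D: "D \<in> carrier_mat p c" and F: "F \<in> carrier_mat n n"
    and onto: "\<forall>z \<in> carrier_vec p. \<exists>a \<in> carrier_vec c. D *\<^sub>v a = z"
    and x0: "x0 \<in> carrier_vec n" and xf: "xf \<in> carrier_vec n"
    and u: "u \<in> carrier_vec p" "C *\<^sub>v u = xf - F *\<^sub>v x0"
  defines "G \<equiv> append_cols D (0\<^sub>m p n)"
    and "H \<equiv> four_block_mat (0\<^sub>m n c) (1\<^sub>m n) (C * D) F"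
  assumes Kb: "kernel_basis_mat H Kb"
  defines "v \<equiv> ((1\<^sub>m p - G * Kb * pinv (G * Kb)) * G * pinv H) *\<^sub>v (x0 @\<^sub>v xf)"
  shows "v \<in> carrier_vec p" and "F *\<^sub>v x0 + C *\<^sub>v v = xf"
    and "\<And>w. w \<in> carrier_vec p \<Longrightarrow> C *\<^sub>v w = 0\<^sub>v n \<Longrightarrow> w \<bullet> v = 0"
proof -
  have CD: "C * D \<in> carrier_mat n c" using C D by simp
  have G: "G \<in> carrier_mat p (c + n)" unfolding G_def using D by simp
  have H: "H \<in> carrier_mat (n + n) (c + n)" unfolding H_def using F by simp
  have Gm: "G *\<^sub>v (a @\<^sub>v z) = D *\<^sub>v a" if "a \<in> carrier_vec c" "z \<in> carrier_vec n" for a z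
    unfolding G_def append_cols_mult_vec[OF D zero_carrier_mat that] using D that by (intro eq_vecI) auto
  have Hm: "H *\<^sub>v (a @\<^sub>v z) = z @\<^sub>v (C *\<^sub>v (D *\<^sub>v a) + F *\<^sub>v z)"
    if "a \<in> carrier_vec c" "z \<in> carrier_vec n" for a z
  proof -
    have "H *\<^sub>v (a @\<^sub>v z) = (0\<^sub>m n c *\<^sub>v a + 1\<^sub>m n *\<^sub>v z) @\<^sub>v ((C * D) *\<^sub>v a + F *\<^sub>v z)"
      unfolding H_def by (rule four_block_mat_mult_vec) (use CD F that in auto)
    moreover have "0\<^sub>m n c *\<^sub>v a + 1\<^sub>m n *\<^sub>v z = z" using that by (intro eq_vecI) auto
    ultimately show ?thesis using assoc_mult_mat_vec[OF C D that(1)] by simp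
  qed
  note k = kernel_basis_mat_kernel[OF H Kb]
  define P where "P = G * Kb"
  define q where "q = dim_col Kb"
  have Kbc: "Kb \<in> carrier_mat (c + n) q" unfolding q_def by (rule k(1))
  have P: "P \<in> carrier_mat p q" unfolding P_def using G Kbc by simp
  note p = pinv_carrier[OF P]
  \<comment> \<open>The upper block row of \<open>H\<close> forces the state part \<open>z\<close>
    of a kernel vector to vanish, so the lower one reduces to \<open>C D a = 0\<close>.\<close>
  have CP: "C *\<^sub>v (P *\<^sub>v y) = 0\<^sub>v n" if y: "y \<in> carrier_vec q" for y
  proof -
    have "Kb *\<^sub>v y \<in> carrier_vec (c + n)" using Kbc y by simp
    then obtain a z where az: "Kb *\<^sub>v y = a @\<^sub>v z" "a \<in> carrier_vec c" "z \<in> carrier_vec n"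
      by (rule append_vec_split)
    have "z @\<^sub>v (C *\<^sub>v (D *\<^sub>v a) + F *\<^sub>v z) = 0\<^sub>v n @\<^sub>v 0\<^sub>v n"
      using k(2)[of y] y unfolding az(1) Hm[OF az(2,3)] q_def zero_vec_append by simp
    then have z: "z = 0\<^sub>v n" and e: "C *\<^sub>v (D *\<^sub>v a) + F *\<^sub>v z = 0\<^sub>v n"
      by (auto simp: append_vec_eq[OF az(3) zero_carrier_vec])
    have "F *\<^sub>v z = 0\<^sub>v n" unfolding z by (rule mult_mat_zero_vec[OF F])
    then have "C *\<^sub>v (D *\<^sub>v a) = 0\<^sub>v n" using e C D az by simp
    then show ?thesis unfolding P_def using assoc_mult_mat_vec[OF G Kbc y] Gm[OF az(2,3)] az(1) by simp
  qed
  \<comment> \<open>Conversely, lift \<open>w\<close> through \<open>D\<close> and pad with a zero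
    state to obtain a kernel vector of \<open>H\<close>.\<close>
  have kerP: "\<exists>y \<in> carrier_vec q. w = P *\<^sub>v y" if w: "w \<in> carrier_vec p" "C *\<^sub>v w = 0\<^sub>v n" for w
  proof -
    obtain a where a: "a \<in> carrier_vec c" "D *\<^sub>v a = w" using bspec[OF onto w(1)] by auto
    have "F *\<^sub>v 0\<^sub>v n = 0\<^sub>v n" by (rule mult_mat_zero_vec[OF F])
    then have "H *\<^sub>v (a @\<^sub>v 0\<^sub>v n) = 0\<^sub>v (n + n)"
      unfolding Hm[OF a(1) zero_carrier_vec] a(2) w(2) by (simp add: zero_vec_append)
    then obtain y where y: "y \<in> carrier_vec q" "a @\<^sub>v 0\<^sub>v n = Kb *\<^sub>v y"
      using k(3)[of "a @\<^sub>v 0\<^sub>v n"] a unfolding q_def by auto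
    then have "P *\<^sub>v y = w" unfolding P_def
      using assoc_mult_mat_vec[OF G Kbc y(1)] Gm[OF a(1) zero_carrier_vec] a(2) by simp
    then show ?thesis using y by auto
  qed
  define b where "b = x0 @\<^sub>v xf"
  have b: "b \<in> carrier_vec (n + n)" unfolding b_def using x0 xf by simp
  note pH = pinv_carrier[OF H]
  define s where "s = pinv H *\<^sub>v b"
  have s: "s \<in> carrier_vec (c + n)" unfolding s_def using pH b by simp
  \<comment> \<open>The steering input \<open>u\<close>, lifted through \<open>D\<close> and paired
    with \<open>x0\<close>, witnesses that \<open>b\<close> is in the range of
    \<open>H\<close>.\<close>
  have Hs: "H *\<^sub>v s = b"
  proof -
    obtain a where a: "a \<in> carrier_vec c" "D *\<^sub>v a = u" using bspec[OF onto u(1)] by auto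
    have "C *\<^sub>v u + F *\<^sub>v x0 = xf" unfolding u(2) using xf F x0 by (intro eq_vecI) auto
    then have "H *\<^sub>v (a @\<^sub>v x0) = b" unfolding Hm[OF a(1) x0] a(2) b_def by simp
    then show ?thesis unfolding s_def using pinv_solves[OF H, of "a @\<^sub>v x0"] a x0 by simp
  qed
  define g where "g = G *\<^sub>v s"
  have g: "g \<in> carrier_vec p" unfolding g_def using G s by simp
  have Cg: "F *\<^sub>v x0 + C *\<^sub>v g = xf"
  proof -
    obtain a z where az: "s = a @\<^sub>v z" "a \<in> carrier_vec c" "z \<in> carrier_vec n"
      using s by (rule append_vec_split)
    have "z @\<^sub>v (C *\<^sub>v (D *\<^sub>v a) + F *\<^sub>v z) = x0 @\<^sub>v xf"
      using Hs unfolding az(1) Hm[OF az(2,3)] b_def .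
    then have "z = x0" "C *\<^sub>v (D *\<^sub>v a) + F *\<^sub>v z = xf"
      by (auto simp: append_vec_eq[OF az(3) x0])
    then have "C *\<^sub>v g + F *\<^sub>v x0 = xf" unfolding g_def az(1) Gm[OF az(2,3)] by simp
    then show ?thesis
      using comm_add_vec[OF mult_mat_vec_carrier[OF F x0] mult_mat_vec_carrier[OF C g]] by simp
  qed
  \<comment> \<open>\<open>E\<close> is the orthogonal projection onto the range of
    \<open>P\<close>, and \<open>v\<close> is \<open>g\<close> minus its projection.\<close>
  define E where "E = P * pinv P"
  have E: "E \<in> carrier_mat p p" and Et: "E\<^sup>T = E" and EP: "E * P = P"
    unfolding E_def using P p transpose_mult_pinv[OF P] mult_pinv_mult[OF P] by auto
  have IE: "1\<^sub>m p - E \<in> carrier_mat p p" by (rule minus_carrier_mat[OF E])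
  have IEG: "(1\<^sub>m p - E) * G \<in> carrier_mat p (c + n)" using IE G by simp
  have ve: "v = g - E *\<^sub>v g"
  proof -
    have "v = (1\<^sub>m p - E) *\<^sub>v g"
      unfolding v_def P_def[symmetric] E_def[symmetric] b_def[symmetric] assoc_mult_mat_vec[OF IEG pH b]
        s_def[symmetric] assoc_mult_mat_vec[OF IE G s] g_def ..
    then show ?thesis using minus_mult_distrib_mat_vec[OF one_carrier_mat E g] g by simp
  qed
  show v: "v \<in> carrier_vec p" unfolding ve using g E by simp
  define y where "y = pinv P *\<^sub>v g"
  have y: "y \<in> carrier_vec q" unfolding y_def using p g by simp
  have Eg: "E *\<^sub>v g = P *\<^sub>v y" unfolding E_def y_def by (rule assoc_mult_mat_vec[OF P p g])
  have "C *\<^sub>v v = C *\<^sub>v g - 0\<^sub>v n"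
    unfolding ve Eg mult_minus_distrib_mat_vec[OF C g mult_mat_vec_carrier[OF P y]] CP[OF y] ..
  also have "\<dots> = C *\<^sub>v g" using C by (intro eq_vecI) auto
  finally show "F *\<^sub>v x0 + C *\<^sub>v v = xf" using Cg by simp
  show "w \<bullet> v = 0" if w: "w \<in> carrier_vec p" "C *\<^sub>v w = 0\<^sub>v n" for w
  proof -
    obtain a where a: "a \<in> carrier_vec q" "w = P *\<^sub>v a" using kerP[OF w] by auto
    \<comment> \<open>As \<open>E\<close> fixes \<open>w\<close> and is symmetric, \<open>w\<close>
      has the same scalar product with \<open>g\<close> as with \<open>E g\<close>.\<close>
    have "E *\<^sub>v w = w" unfolding a(2) using assoc_mult_mat_vec[OF E P a(1)] EP by simp
    then have "w \<bullet> g = w \<bullet> (E *\<^sub>v g)" using transpose_vec_mult_scalar[OF E g w(1)] Et by simp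
    then show ?thesis unfolding ve using w g E by (subst scalar_prod_minus_distrib[of _ p]) auto
  qed
qed

theorem theorem4p1:
  fixes n m M T l :: nat
    and A B :: "real mat"
    and Th N :: "nat \<Rightarrow> nat"
    and U X0 X :: "nat \<Rightarrow> real mat"
    and k :: "nat \<Rightarrow> nat"
    and x0 xf :: "real vec"
    and K :: "real mat \<Rightarrow> real mat"
    and Ut Xt Q :: "nat \<Rightarrow> real mat"
    and G H :: "real mat"
  assumes "n \<ge> 1" and "m \<ge> 1"
    and "A \<in> carrier_mat n n" and "B \<in> carrier_mat n m"
    and "inj_on Th {1..M}"
    and "\<And>i. i \<in> {1..M} \<Longrightarrow> Th i \<ge> 1"
    and "\<And>i. i \<in> {1..M} \<Longrightarrow> experiments A B (Th i) (N i) (U i) (X0 i) (X i)"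
    and "T \<ge> 1"
    and "\<And>i. i \<in> {1..l} \<Longrightarrow> k i \<in> {1..M}"
    and "(\<Sum>i=1..l. Th (k i)) = T"
    and "x0 \<in> carrier_vec n" and "xf \<in> carrier_vec n"
    and "reachable A B T x0 xf"
    and "\<And>i. i \<in> {1..l} \<Longrightarrow> full_row_rank (X0 (k i) @\<^sub>r U (k i))"
    and "\<And>P. kernel_basis_mat P (K P)"
  defines "Ut \<equiv> \<lambda>i. U (k i) * K (X0 (k i))"
    and "Xt \<equiv> \<lambda>i. X (k i) * K (X0 (k i))"
    and "Q \<equiv> \<lambda>i. X (k i) * K (U (k i)) * pinv (X0 (k i) * K (U (k i)))"
    and "G \<equiv> G_mat n l Ut"
    and "H \<equiv> H_mat n l Xt Q"
  shows "min_energy_control A B T x0 xf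
    (((1\<^sub>m (m * T) - G * K H * pinv (G * K H)) * G * pinv H) *\<^sub>v (x0 @\<^sub>v xf))"
proof -
  note prems = assms(1-15)
  define \<tau> where "\<tau> = (\<lambda>i. Th (k i))"
  have A: "A \<in> carrier_mat n n" and B: "B \<in> carrier_mat n m" by fact+
  have K: "kernel_basis_mat P (K P)" for P by fact
  have T: "(\<Sum>i = 1..l. \<tau> i) = T" unfolding \<tau>_def by fact
  have ex: "experiments A B (\<tau> i) (N (k i)) (U (k i)) (X0 (k i)) (X (k i))" if "i \<in> {1..l}" for i
    unfolding \<tau>_def by (rule prems(7)[OF prems(9)[OF that]])
  have Uc: "U (k i) \<in> carrier_mat (m * \<tau> i) (N (k i))" and X0c: "X0 (k i) \<in> carrier_mat n (N (k i))"
    if "i \<in> {1..l}" for i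
    using ex[OF that] A B unfolding experiments_def by auto
  have Utr: "dim_row (Ut i) = m * \<tau> i" if "i \<in> {1..l}" for i unfolding Ut_def using Uc[OF that] by simp
  have Xt: "Xt i = ctrb A B (\<tau> i) * Ut i" if "i \<in> {1..l}" for i
    unfolding Xt_def Ut_def by (rule zero_state_experiments[OF A B ex[OF that] K])
  have Q: "Q i = A ^\<^sub>m \<tau> i" if "i \<in> {1..l}" for i
    unfolding Q_def by (rule zero_input_experiments[OF A B ex[OF that] K prems(14)[OF that]])
  have Ut_onto: "\<forall>z \<in> carrier_vec (dim_row (Ut i)). \<exists>x \<in> carrier_vec (dim_col (Ut i)). Ut i *\<^sub>v x = z"
    if i: "i \<in> {1..l}" for i
  proof
    fix z :: "real vec" assume "z \<in> carrier_vec (dim_row (Ut i))"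
    then have z: "z \<in> carrier_vec (m * \<tau> i)" unfolding Utr[OF i] .
    \<comment> \<open>Prescribe the input \<open>z\<close> together with the zero initial
      state.\<close>
    have "\<exists>w \<in> carrier_vec (N (k i)). U (k i) *\<^sub>v w = z \<and> X0 (k i) *\<^sub>v w = 0\<^sub>v n"
      using append_rows_surj[OF X0c[OF i] Uc[OF i] prems(14)[OF i] zero_carrier_vec z] by metis
    from mult_kernel_basis_surj[OF Uc[OF i] X0c[OF i] K this]
    show "\<exists>x \<in> carrier_vec (dim_col (Ut i)). Ut i *\<^sub>v x = z" unfolding Ut_def by simp
  qed
  define D where "D = diag_block_mat (map Ut (rev [1..<Suc l]))"
  define c where "c = dim_col D"
  have blocks: "dim_row D = m * T"
    "block_row n (map (\<lambda>i. Q_prod n l Q (Suc i) * Xt i) (rev [1..<Suc l])) = ctrb A B T * D"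
    "Q_prod n l Q 1 = A ^\<^sub>m T"
    unfolding D_def T[symmetric]
    by (rule concatenated_blocks[OF A B]; rule Utr Xt Q; assumption)+
  have D: "D \<in> carrier_mat (m * T) c" unfolding c_def using blocks(1) by auto
  have "\<forall>z \<in> carrier_vec (dim_row D). \<exists>a \<in> carrier_vec (dim_col D). D *\<^sub>v a = z"
    unfolding D_def
  proof (rule block_diag_surj)
    fix P assume "P \<in> set (map Ut (rev [1..<Suc l]))"
    then have "P \<in> Ut ` {1..l}" by (simp del: upt_Suc add: atLeastLessThanSuc_atLeastAtMost)
    then show "\<forall>z \<in> carrier_vec (dim_row P). \<exists>x \<in> carrier_vec (dim_col P). P *\<^sub>v x = z"
      using Ut_onto by blast
  qed
  then have D_onto: "\<forall>z \<in> carrier_vec (m * T). \<exists>a \<in> carrier_vec c. D *\<^sub>v a = z"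
    unfolding carrier_matD(1)[OF D] c_def .
  note C = ctrb_carrier[OF A B, of T]
  have G: "G = append_cols D (0\<^sub>m (m * T) n)"
    unfolding G_def G_mat_def D_def[symmetric] Let_def using D by simp
  have H: "H = four_block_mat (0\<^sub>m n c) (1\<^sub>m n) (ctrb A B T * D) (A ^\<^sub>m T)"
    unfolding H_def H_mat_def Let_def blocks(2,3) c_def index_mult_mat(3) ..
  have AT: "A ^\<^sub>m T \<in> carrier_mat n n" using A by simp
  from \<open>reachable A B T x0 xf\<close> obtain u where u: "u \<in> carrier_vec (m * T)"
    "ctrb A B T *\<^sub>v u = xf - A ^\<^sub>m T *\<^sub>v x0"
    unfolding reachable_def carrier_matD(2)[OF C] by auto
  \<comment> \<open>The data matrices now have the abstract form required, with the controllability
    matrix for \<open>C\<close> and the \<open>T\<close>-th power of \<open>A\<close> for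
    \<open>F\<close>.\<close>
  note sol = projected_solution[OF C D AT D_onto prems(11,12) u K, folded G H]
  show ?thesis
    by (rule orthogonal_min_energy[OF A B prems(11) sol(1,2)]) (rule sol(3))
qed

end
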